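(* For any regular point $R\in\mathcal{M}_r$, there exists $\epsilon>0$ such that for any $V\in\mathrm{B}_\epsilon(R)$ the following holds. Let $V'=V-\frac{ee_1^\top}{2}$ and let $\{\Theta^k\}_{k\ge0}\subset\mathbb{R}^{m\times r}$ be a sequence generated by the generalized Weiszfeld algorithm $$\Theta^{k+1}=T(\Theta^k):=-\big(A\operatorname{Diag}(v^k)A^\top\big)^{-1}A\big(b'+\operatorname{Diag}(v^k)V'\big),$$ where $v^k\in\mathbb{R}^n$ is given by $v^k_i=1/\|(V'+A^\top\Theta^k)_i\|$ for $i\in B$ and $v^k_i=2$ for $i\in[n]\setminus B$. If the sequence $\{\Theta^k\}_{k\ge0}$ has an accumulation point $\bar\Theta$, and every row of $(V'+A^\top\bar\Theta)_B$ and of $(V'+A^\top\Theta^k)_B$ is non-zero for all $k\ge0$, then $\bar\Theta$ is a global minimum of $$G(\Theta)=\sum_{i\in B}\|(V'+A^\top\Theta)_i\|+\sum_{i\in[n]\setminus B}\|(V'+A^\top\Theta)_i\|^2+\langle b',A^\top\Theta\rangle,\qquad\Theta\in\mathbb{R}^{m\times r}.$$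
   Context: $n,m,r$ are positive integers, $A\in\mathbb{R}^{m\times n}$ has full row rank, $b\in\mathbb{R}^m$ with $b\ge0$, $B\subseteq[n]=\{1,\dots,n\}$. $e\in\mathbb{R}^n$ is the all-ones vector, $e_1\in\mathbb{R}^r$ the first standard unit vector, $\langle X,Y\rangle=\operatorname{Tr}(XY^\top)$. $b'\in\mathbb{R}^{n\times r}$ is a fixed matrix with $Ab'=(Ae-2b)e_1^\top$. $X_i$ denotes the $i$-th row of $X$ and $X_B$ the submatrix of rows indexed by $B$; $\operatorname{diag}_B(X)=(X_{ii})_{i\in B}$; $\operatorname{Diag}(v)$ is the diagonal matrix with diagonal $v$. $\mathcal{M}_r=\{R\in\mathbb{R}^{n\times r}: AR=be_1^\top,\ \operatorname{diag}_B(RR^\top)-R_Be_1=0\}$. A point $R\in\mathcal{M}_r$ is regular if the gradients at $R$ of the $mr+|B|$ scalar constraint functions defining $\mathcal{M}_r$ are linearly independent (LICQ). $\mathrm{B}_\epsilon(R)$ is the open ball in $\mathbb{R}^{n\times r}$ of radius $\epsilon$ around $R$ in Frobenius norm. *)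

theory Defs
  imports "HOL-Analysis.Analysis"
begin

text \<open>
  An \<open>m \<times> n\<close> matrix has type \<open>real^'n^'m\<close>, so \<open>X $ i\<close> is the \<open>i\<close>-th row of \<open>X\<close>. The norm of
  \<open>real^'r^'n\<close> is the Euclidean norm of the vector of row norms, i.e. the Frobenius norm, and
  \<open>ball\<close> is taken with respect to it.
\<close>

definition e1 :: "real^'r::{finite,linorder}" where
  "e1 = axis (Min UNIV) 1"

definition outer :: "real^'m \<Rightarrow> real^'r \<Rightarrow> real^'r^'m" where
  "outer u w = (\<chi> i j. u $ i * w $ j)"

definition Diag :: "real^'n \<Rightarrow> real^'n^'n" where
  "Diag v = (\<chi> i j. if i = j then v $ i else 0)"

definition frob_inner :: "real^'r^'n \<Rightarrow> real^'r^'n \<Rightarrow> real" where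
  "frob_inner X Y = trace (X ** transpose Y)"

definition feasible ::
    "real^'n^'m \<Rightarrow> real^'m \<Rightarrow> 'n set \<Rightarrow> (real^'r::{finite,linorder}^'n) set" where
  "feasible A b B =
    {R. A ** R = outer b e1 \<and> (\<forall>i\<in>B. (R ** transpose R) $ i $ i - (R *v e1) $ i = 0)}"

text \<open>
  The scalar constraint functions: \<open>Inl (i, j)\<close> indexes the entries of \<open>A ** R - outer b e1\<close>,
  and \<open>Inr i\<close> with \<open>i \<in> B\<close> the diagonal constraints.
\<close>

definition constraint ::
    "real^'n^'m \<Rightarrow> real^'m \<Rightarrow> ('m \<times> 'r) + 'n \<Rightarrow> real^'r::{finite,linorder}^'n \<Rightarrow> real" where
  "constraint A b c R =
    (case c of
       Inl (i, j) \<Rightarrow> (A ** R - outer b e1) $ i $ j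
     | Inr i \<Rightarrow> (R ** transpose R) $ i $ i - (R *v e1) $ i)"

definition constraint_indices :: "'n set \<Rightarrow> (('m \<times> 'r) + 'n) set" where
  "constraint_indices B = UNIV <+> B"

lemma feasible_iff_constraint:
  "R \<in> feasible A b B \<longleftrightarrow> (\<forall>c\<in>constraint_indices B. constraint A b c R = 0)"
  by (simp add: feasible_def constraint_def constraint_indices_def vec_eq_iff Plus_def ball_Un)

text \<open>
  LICQ is linear independence of the gradients as an indexed family; injectivity excludes
  two constraints sharing a gradient, which \<open>independent\<close> of the image set alone would not detect.
\<close>

definition regular_point ::
    "real^'n^'m \<Rightarrow> real^'m \<Rightarrow> 'n set \<Rightarrow> real^'r::{finite,linorder}^'n \<Rightarrow> bool" where
  "regular_point A b B R \<longleftrightarrow>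
    R \<in> feasible A b B \<and>
    (\<exists>g. (\<forall>c\<in>constraint_indices B. GDERIV (constraint A b c) R :> g c) \<and>
         inj_on g (constraint_indices B) \<and>
         independent (g ` constraint_indices B))"

definition weiszfeld_weights ::
    "real^'n^'m \<Rightarrow> 'n set \<Rightarrow> real^'r^'n \<Rightarrow> real^'r^'m \<Rightarrow> real^'n" where
  "weiszfeld_weights A B V' \<Theta> =
    (\<chi> i. if i \<in> B then 1 / norm ((V' + transpose A ** \<Theta>) $ i) else 2)"

definition weiszfeld_step ::
    "real^'n^'m \<Rightarrow> 'n set \<Rightarrow> real^'r^'n \<Rightarrow> real^'r^'n \<Rightarrow> real^'r^'m \<Rightarrow> real^'r^'m" where
  "weiszfeld_step A B b' V' \<Theta> =
    (let D = Diag (weiszfeld_weights A B V' \<Theta>)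
     in - (matrix_inv (A ** D ** transpose A) ** (A ** (b' + D ** V'))))"

definition weiszfeld_objective ::
    "real^'n^'m \<Rightarrow> 'n set \<Rightarrow> real^'r^'n \<Rightarrow> real^'r^'n \<Rightarrow> real^'r^'m \<Rightarrow> real" where
  "weiszfeld_objective A B b' V' \<Theta> =
    (\<Sum>i\<in>B. norm ((V' + transpose A ** \<Theta>) $ i))
    + (\<Sum>i\<in>- B. (norm ((V' + transpose A ** \<Theta>) $ i))\<^sup>2)
    + frob_inner b' (transpose A ** \<Theta>)"

definition accumulation_point :: "(nat \<Rightarrow> 'a::topological_space) \<Rightarrow> 'a \<Rightarrow> bool" where
  "accumulation_point x l \<longleftrightarrow> (\<exists>s. strict_mono s \<and> (x \<circ> s) \<longlonglongrightarrow> l)"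

end

theory Submission
  imports Defs
begin

text \<open>
  The algorithm is a majorization-minimization scheme for the convex function \<open>G\<close>. Write
  \<open>W = V' + A\<^sup>T \<Theta>\<close> and let \<open>v\<close> be the weights at \<open>\<Theta>\<close>. From
  \<open>\<parallel>w'\<parallel> \<le> \<parallel>w'\<parallel>\<^sup>2 / (2 \<parallel>w\<parallel>) + \<parallel>w\<parallel> / 2\<close>, with equality at \<open>w' = w\<close>, the quadratic function
  \<open>\<Theta>' \<mapsto> \<Sum>\<^sub>i v\<^sub>i \<parallel>W'\<^sub>i\<parallel>\<^sup>2 / 2 + \<langle>b', A\<^sup>T \<Theta>'\<rangle>\<close> majorizes \<open>G\<close> up to a constant and touches it at
  \<open>\<Theta>\<close>. As \<open>A\<close> has full row rank and the weights are positive, it has a unique minimizer, and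
  \<open>T \<Theta>\<close> is that minimizer: \<open>A (b' + Diag v W\<^sup>+) = 0\<close> for \<open>W\<^sup>+ = V' + A\<^sup>T T(\<Theta>)\<close>
  (\<open>weiszfeld_step_stationary\<close>). Comparing its values at \<open>\<Theta>\<close> and \<open>T \<Theta>\<close> shows that a step lowers
  \<open>G\<close> by at least \<open>\<Sum>\<^sub>i v\<^sub>i \<parallel>W\<^sup>+\<^sub>i - W\<^sub>i\<parallel>\<^sup>2 / 2\<close> (\<open>weiszfeld_step_descent\<close>).

  Along a subsequence converging to \<open>\<Theta>bar\<close> the values of \<open>G\<close> converge, so the decrease per step
  tends to zero. The weights there converge to the weights at \<open>\<Theta>bar\<close>, which are positive, and so
  \<open>W\<^sup>+ - W\<close> tends to zero. The equation for \<open>W\<^sup>+\<close> passes to the limit and becomes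
  \<open>A (b' + Diag v W) = 0\<close> at \<open>\<Theta>bar\<close> (\<open>weiszfeld_accumulation_point_stationary\<close>). Its left side is
  the gradient of \<open>G\<close> at \<open>\<Theta>bar\<close>, and a stationary point of a convex function is a global minimum
  (\<open>weiszfeld_stationary_imp_global_min\<close>).
\<close>

lemma frob_inner_eq_inner: "frob_inner X Y = X \<bullet> Y"
  by (simp add: frob_inner_def trace_def matrix_matrix_mult_def transpose_def inner_vec_def)

lemma inner_matrix_mult_left: "(A ** X) \<bullet> Y = X \<bullet> (transpose A ** Y)"
  for A :: "real^'n^'m" and X :: "real^'r^'n" and Y :: "real^'r^'m"
proof -
  have "(A ** X) \<bullet> Y = (\<Sum>i\<in>UNIV. \<Sum>k\<in>UNIV. \<Sum>j\<in>UNIV. A $ i $ j * X $ j $ k * Y $ i $ k)"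
    by (simp add: inner_vec_def matrix_matrix_mult_def sum_distrib_right)
  also have "\<dots> = (\<Sum>i\<in>UNIV. \<Sum>j\<in>UNIV. \<Sum>k\<in>UNIV. A $ i $ j * X $ j $ k * Y $ i $ k)"
    by (intro sum.cong refl sum.swap)
  also have "\<dots> = (\<Sum>j\<in>UNIV. \<Sum>i\<in>UNIV. \<Sum>k\<in>UNIV. A $ i $ j * X $ j $ k * Y $ i $ k)"
    by (rule sum.swap)
  also have "\<dots> = (\<Sum>j\<in>UNIV. \<Sum>k\<in>UNIV. \<Sum>i\<in>UNIV. A $ i $ j * X $ j $ k * Y $ i $ k)"
    by (intro sum.cong refl sum.swap)
  also have "\<dots> = X \<bullet> (transpose A ** Y)"
    by (simp add: inner_vec_def matrix_matrix_mult_def transpose_def sum_distrib_left mult_ac)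
  finally show ?thesis .
qed

lemma row_Diag_mult: "(Diag v ** X) $ i = v $ i *\<^sub>R X $ i"
  by (simp add: vec_eq_iff matrix_matrix_mult_def Diag_def if_distrib if_distribR
      sum.delta cong: if_cong)

lemma Diag_mult_vector: "(Diag v *v x) $ i = v $ i * x $ i"
  by (simp add: matrix_vector_mult_def Diag_def if_distrib if_distribR sum.delta cong: if_cong)

lemma linear_matrix_mult_left: "linear ((**) A)"
  for A :: "real^'n^'m"
  by (rule linearI)
    (simp_all add: vec_eq_iff matrix_matrix_mult_def sum_distrib_left sum.distrib algebra_simps)

lemma tendsto_matrix_mult_left:
  fixes A :: "real^'n^'m"
  assumes "(f \<longlongrightarrow> X) F"
  shows "((\<lambda>x. A ** f x) \<longlongrightarrow> A ** X) F"
  using linear_matrix_mult_left[of A] assms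
  unfolding linear_conv_bounded_linear by (rule bounded_linear.tendsto)

text \<open>
  The matrix is positive definite: its quadratic form at \<open>x\<close> is \<open>\<Sum>\<^sub>i v\<^sub>i (A\<^sup>T x)\<^sub>i\<^sup>2\<close>, and full row
  rank makes \<open>A\<^sup>T\<close> injective.
\<close>

lemma invertible_weighted_gram:
  fixes A :: "real^'n^'m"
  assumes rank: "rank A = CARD('m)" and pos: "\<And>i. v $ i > 0"
  shows "invertible (A ** Diag v ** transpose A)"
proof -
  have inj: "inj ((*v) (transpose A))"
    using rank by (simp add: rank_transpose flip: full_rank_injective)
  have "x = 0" if "(A ** Diag v ** transpose A) *v x = 0" for x
  proof -
    let ?y = "transpose A *v x"
    have "A *v (Diag v *v ?y) = 0"
      using that by (simp only: matrix_vector_mul_assoc matrix_mul_assoc)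
    then have "(Diag v *v ?y) \<bullet> ?y = 0"
      by (metis dot_lmul_matrix inner_commute inner_zero_left transpose_matrix_vector)
    then have "(\<Sum>i\<in>UNIV. v $ i * (?y $ i * ?y $ i)) = 0"
      by (simp add: inner_vec_def Diag_mult_vector mult.assoc)
    then have "\<forall>i. v $ i * (?y $ i * ?y $ i) = 0"
      using pos by (subst (asm) sum_nonneg_eq_0_iff) (auto simp: less_imp_le)
    then have "?y = 0"
      using pos by (auto simp: vec_eq_iff) (metis less_irrefl)
    then show "x = 0"
      using inj by (metis injD matrix_vector_mult_0_right)
  qed
  then show ?thesis
    by (simp add: invertible_left_inverse matrix_left_invertible_ker)
qed

lemma invertible_matrix_inv_right: "invertible M \<Longrightarrow> M ** matrix_inv M = mat 1"
  unfolding invertible_def matrix_inv_def by (rule someI2_ex) auto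

lemma weiszfeld_weights_pos:
  assumes "\<forall>i\<in>B. (V' + transpose A ** \<Theta>) $ i \<noteq> 0"
  shows "weiszfeld_weights A B V' \<Theta> $ i > 0"
  using assms by (simp add: weiszfeld_weights_def)

text \<open>
  The normal equation of the majorizing least-squares problem: its gradient at \<open>T \<Theta>\<close> vanishes.
\<close>

lemma weiszfeld_step_stationary:
  fixes A :: "real^'n^'m"
  assumes "rank A = CARD('m)"
    and "\<forall>i\<in>B. (V' + transpose A ** \<Theta>) $ i \<noteq> 0"
  shows "A ** (b' + Diag (weiszfeld_weights A B V' \<Theta>)
           ** (V' + transpose A ** weiszfeld_step A B b' V' \<Theta>)) = 0"
proof -
  let ?D = "Diag (weiszfeld_weights A B V' \<Theta>)"
  let ?M = "A ** ?D ** transpose A"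
  let ?c = "A ** (b' + ?D ** V')"
  have "?M ** matrix_inv ?M = mat 1"
    using invertible_weighted_gram[OF assms(1) weiszfeld_weights_pos[OF assms(2)]]
    by (rule invertible_matrix_inv_right)
  then have "?M ** (matrix_inv ?M ** ?c) = ?c"
    by (simp add: matrix_mul_assoc)
  then have "?M ** weiszfeld_step A B b' V' \<Theta> = - ?c"
    unfolding weiszfeld_step_def Let_def
    by (simp add: linear_neg[OF linear_matrix_mult_left])
  then show ?thesis
    by (simp add: matrix_add_ldistrib matrix_mul_assoc)
qed

text \<open>
  The two sums are \<open>\<langle>A (b' + Diag v Y), \<Phi>\<rangle>\<close> with \<open>A\<close> moved to the other side; in this form
  stationarity cancels the linear terms in both estimates of the objective below.
\<close>

lemma stationary_inner_eq_0:
  fixes A :: "real^'n^'m" and Y :: "real^'r^'n"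
  assumes "A ** (b' + Diag v ** Y) = 0"
  shows "(\<Sum>i\<in>UNIV. v $ i * (Y $ i \<bullet> (transpose A ** \<Phi>) $ i)) + b' \<bullet> (transpose A ** \<Phi>) = 0"
proof -
  have "(b' + Diag v ** Y) \<bullet> (transpose A ** \<Phi>) = 0"
    using assms by (simp flip: inner_matrix_mult_left)
  moreover have "(Diag v ** Y) \<bullet> Z = (\<Sum>i\<in>UNIV. v $ i * (Y $ i \<bullet> Z $ i))" for Z
    by (simp add: inner_vec_def[of "Diag v ** Y"] row_Diag_mult)
  ultimately show ?thesis
    by (simp add: inner_add_left)
qed

lemma weiszfeld_objective_eq:
  "weiszfeld_objective A B b' V' \<Theta> =
    (\<Sum>i\<in>UNIV. if i \<in> B then norm ((V' + transpose A ** \<Theta>) $ i)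
              else (norm ((V' + transpose A ** \<Theta>) $ i))\<^sup>2)
    + b' \<bullet> (transpose A ** \<Theta>)"
  by (simp add: weiszfeld_objective_def frob_inner_eq_inner sum.If_cases Compl_eq)

text \<open>
  Tangent line at \<open>\<Theta>\<close>: the convexity inequality for each summand has slope \<open>v\<^sub>i W\<^sub>i\<close>, also for
  \<open>i \<notin> B\<close>, which is why the weight there is \<open>2\<close>.
\<close>

lemma weiszfeld_stationary_imp_global_min:
  fixes A :: "real^'n^'m" and V' b' :: "real^'r^'n"
  assumes nz: "\<forall>i\<in>B. (V' + transpose A ** \<Theta>) $ i \<noteq> 0"
    and stat: "A ** (b' + Diag (weiszfeld_weights A B V' \<Theta>) ** (V' + transpose A ** \<Theta>)) = 0"
  shows "weiszfeld_objective A B b' V' \<Theta> \<le> weiszfeld_objective A B b' V' \<Phi>"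
proof -
  define W where "W = V' + transpose A ** \<Theta>"
  define d where "d = transpose A ** (\<Phi> - \<Theta>)"
  define v where "v = weiszfeld_weights A B V' \<Theta>"
  define f where "f i x = (if i \<in> B then norm x else (norm x)\<^sup>2)" for i :: 'n and x :: "real^'r"
  have residual: "V' + transpose A ** \<Phi> = W + d"
    by (simp add: W_def d_def linear_diff[OF linear_matrix_mult_left])
  have linear_part: "b' \<bullet> (transpose A ** \<Phi>) = b' \<bullet> (transpose A ** \<Theta>) + b' \<bullet> d"
    by (simp add: d_def linear_diff[OF linear_matrix_mult_left] inner_diff_right)
  have tangent: "v $ i * (W $ i \<bullet> d $ i) \<le> f i (W $ i + d $ i) - f i (W $ i)" for i
  proof (cases "i \<in> B")
    case True
    have "norm (W $ i) > 0"
      using nz True by (simp add: W_def)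
    moreover have "W $ i \<bullet> (W $ i + d $ i) \<le> norm (W $ i) * norm (W $ i + d $ i)"
      by (rule norm_cauchy_schwarz)
    ultimately show ?thesis
      using True
      by (simp add: v_def weiszfeld_weights_def f_def inner_add_right dot_square_norm
          power2_eq_square algebra_simps field_simps flip: W_def)
  next
    case False
    have "2 * (W $ i \<bullet> d $ i) \<le> (norm (W $ i + d $ i))\<^sup>2 - (norm (W $ i))\<^sup>2"
      by (simp add: power2_norm_eq_inner inner_add_left inner_add_right inner_commute)
    then show ?thesis
      using False by (simp add: v_def weiszfeld_weights_def f_def)
  qed
  have "0 = (\<Sum>i\<in>UNIV. v $ i * (W $ i \<bullet> d $ i)) + b' \<bullet> d"
    using stationary_inner_eq_0[OF stat] by (simp add: W_def v_def d_def)
  also have "\<dots> \<le> (\<Sum>i\<in>UNIV. f i (W $ i + d $ i) - f i (W $ i)) + b' \<bullet> d"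
    using tangent by (intro add_mono sum_mono) auto
  also have "\<dots> = weiszfeld_objective A B b' V' \<Phi> - weiszfeld_objective A B b' V' \<Theta>"
    by (simp add: weiszfeld_objective_eq residual linear_part sum_subtractf f_def cong: if_cong
        flip: W_def)
  finally show ?thesis
    by simp
qed

text \<open>
  The majorizing quadratic has Hessian \<open>A Diag(v) A\<^sup>T\<close> and its minimum at \<open>T \<Theta>\<close>, so its drop from
  \<open>\<Theta>\<close> is exactly the sum; the objective drops at least as much, since it agrees with the
  majorant at \<open>\<Theta>\<close> and lies below it at \<open>T \<Theta>\<close>.
\<close>

lemma weiszfeld_step_descent:
  fixes A :: "real^'n^'m" and V' b' :: "real^'r^'n"
  assumes rank: "rank A = CARD('m)"
    and nz: "\<forall>i\<in>B. (V' + transpose A ** \<Theta>) $ i \<noteq> 0"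
  shows "(\<Sum>i\<in>UNIV. weiszfeld_weights A B V' \<Theta> $ i / 2 *
            (norm ((transpose A ** (weiszfeld_step A B b' V' \<Theta> - \<Theta>)) $ i))\<^sup>2)
         \<le> weiszfeld_objective A B b' V' \<Theta>
           - weiszfeld_objective A B b' V' (weiszfeld_step A B b' V' \<Theta>)"
proof -
  define \<Theta>' where "\<Theta>' = weiszfeld_step A B b' V' \<Theta>"
  define W where "W = V' + transpose A ** \<Theta>"
  define d where "d = transpose A ** (\<Theta>' - \<Theta>)"
  define v where "v = weiszfeld_weights A B V' \<Theta>"
  define f where "f i x = (if i \<in> B then norm x else (norm x)\<^sup>2)" for i :: 'n and x :: "real^'r"
  have residual: "V' + transpose A ** \<Theta>' = W + d"
    by (simp add: W_def d_def linear_diff[OF linear_matrix_mult_left])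
  have linear_part: "b' \<bullet> (transpose A ** \<Theta>') = b' \<bullet> (transpose A ** \<Theta>) + b' \<bullet> d"
    by (simp add: d_def linear_diff[OF linear_matrix_mult_left] inner_diff_right)
  have majorant: "v $ i / 2 * ((norm (W $ i))\<^sup>2 - (norm (W $ i + d $ i))\<^sup>2)
      \<le> f i (W $ i) - f i (W $ i + d $ i)" for i
  proof (cases "i \<in> B")
    case True
    have "norm (W $ i) > 0"
      using nz True by (simp add: W_def)
    moreover have "0 \<le> (norm (W $ i) - norm (W $ i + d $ i))\<^sup>2"
      by simp
    ultimately show ?thesis
      using True
      by (simp add: v_def weiszfeld_weights_def f_def power2_eq_square field_simps flip: W_def)
  next
    case False
    then show ?thesis
      by (simp add: v_def weiszfeld_weights_def f_def)
  qed
  have expand: "v $ i / 2 * ((norm (W $ i))\<^sup>2 - (norm (W $ i + d $ i))\<^sup>2)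
      = v $ i / 2 * (norm (d $ i))\<^sup>2 - v $ i * ((W + d) $ i \<bullet> d $ i)" for i
    by (simp add: power2_norm_eq_inner inner_add_left inner_add_right inner_commute algebra_simps)
  have "A ** (b' + Diag v ** (W + d)) = 0"
    using weiszfeld_step_stationary[OF rank nz, of b']
    by (simp add: v_def residual flip: \<Theta>'_def)
  then have "(\<Sum>i\<in>UNIV. v $ i * ((W + d) $ i \<bullet> d $ i)) + b' \<bullet> d = 0"
    unfolding d_def by (rule stationary_inner_eq_0)
  then have "(\<Sum>i\<in>UNIV. v $ i / 2 * (norm (d $ i))\<^sup>2)
      = (\<Sum>i\<in>UNIV. v $ i / 2 * ((norm (W $ i))\<^sup>2 - (norm (W $ i + d $ i))\<^sup>2)) - b' \<bullet> d"
    unfolding expand sum_subtractf by linarith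
  also have "\<dots> \<le> (\<Sum>i\<in>UNIV. f i (W $ i) - f i (W $ i + d $ i)) - b' \<bullet> d"
    using majorant by (intro diff_mono sum_mono) auto
  also have "\<dots> = weiszfeld_objective A B b' V' \<Theta> - weiszfeld_objective A B b' V' \<Theta>'"
    by (simp add: weiszfeld_objective_eq residual linear_part sum_subtractf f_def cong: if_cong
        flip: W_def)
  finally show ?thesis
    by (simp add: \<Theta>'_def d_def v_def)
qed

lemma tendsto_weiszfeld_objective:
  assumes "(\<Theta> \<longlongrightarrow> L) F"
  shows "((\<lambda>k. weiszfeld_objective A B b' V' (\<Theta> k)) \<longlongrightarrow> weiszfeld_objective A B b' V' L) F"
  unfolding weiszfeld_objective_def frob_inner_eq_inner
  by (intro tendsto_intros tendsto_matrix_mult_left assms)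

lemma tendsto_weiszfeld_weights:
  assumes "(\<Theta> \<longlongrightarrow> L) F"
    and "\<forall>i\<in>B. (V' + transpose A ** L) $ i \<noteq> 0"
  shows "((\<lambda>k. weiszfeld_weights A B V' (\<Theta> k) $ i) \<longlongrightarrow> weiszfeld_weights A B V' L $ i) F"
proof (cases "i \<in> B")
  case True
  then have "((\<lambda>k. 1 / norm ((V' + transpose A ** \<Theta> k) $ i))
      \<longlongrightarrow> 1 / norm ((V' + transpose A ** L) $ i)) F"
    using assms by (intro tendsto_intros tendsto_matrix_mult_left) auto
  with True show ?thesis
    by (simp add: weiszfeld_weights_def)
qed (simp add: weiszfeld_weights_def)

text \<open>
  The equation at step \<open>k\<close> mixes the weights at \<open>\<Theta> k\<close> with the residual \<open>V' + A\<^sup>T \<Theta>\<close> at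
  \<open>\<Theta> (Suc k)\<close>. Along the subsequence the descent estimate forces consecutive residuals together,
  so in the limit both are taken at \<open>L\<close>.
\<close>

lemma weiszfeld_accumulation_point_stationary:
  fixes A :: "real^'n^'m" and \<Theta> :: "nat \<Rightarrow> real^'r^'m"
  assumes rank: "rank A = CARD('m)"
    and step: "\<And>k. \<Theta> (Suc k) = weiszfeld_step A B b' V' (\<Theta> k)"
    and nz: "\<And>k. \<forall>i\<in>B. (V' + transpose A ** \<Theta> k) $ i \<noteq> 0"
    and acc: "accumulation_point \<Theta> L"
    and nzL: "\<forall>i\<in>B. (V' + transpose A ** L) $ i \<noteq> 0"
  shows "A ** (b' + Diag (weiszfeld_weights A B V' L) ** (V' + transpose A ** L)) = 0"
proof -
  obtain s where s: "strict_mono s" and lim: "(\<lambda>k. \<Theta> (s k)) \<longlonglongrightarrow> L"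
    using acc by (auto simp: accumulation_point_def o_def)
  define G where "G k = weiszfeld_objective A B b' V' (\<Theta> k)" for k
  define v where "v k = weiszfeld_weights A B V' (\<Theta> k)" for k
  define vL where "vL = weiszfeld_weights A B V' L"
  define d where "d k = transpose A ** (\<Theta> (Suc k) - \<Theta> k)" for k
  have descent: "(\<Sum>i\<in>UNIV. v k $ i / 2 * (norm (d k $ i))\<^sup>2) \<le> G k - G (Suc k)" for k
    using weiszfeld_step_descent[OF rank nz[of k], of b']
    by (simp add: G_def v_def d_def step)
  have v_pos: "v k $ i > 0" for k i
    unfolding v_def by (rule weiszfeld_weights_pos[OF nz])
  have vL_pos: "vL $ i > 0" for i
    unfolding vL_def by (rule weiszfeld_weights_pos[OF nzL])
  have v_lim: "(\<lambda>k. v (s k) $ i) \<longlonglongrightarrow> vL $ i" for i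
    unfolding v_def vL_def by (rule tendsto_weiszfeld_weights[OF lim nzL])
  have row_le: "v k $ i / 2 * (norm (d k $ i))\<^sup>2 \<le> G k - G (Suc k)" for k i
  proof -
    have "v k $ i / 2 * (norm (d k $ i))\<^sup>2 \<le> (\<Sum>i\<in>UNIV. v k $ i / 2 * (norm (d k $ i))\<^sup>2)"
      using v_pos by (intro member_le_sum) (auto simp: less_imp_le)
    with descent show ?thesis
      by (rule order_trans[rotated])
  qed
  have "G (Suc k) \<le> G k" for k
    using row_le[of k undefined] v_pos[of k undefined]
    by (smt (verit) divide_nonneg_nonneg mult_nonneg_nonneg zero_le_power2)
  then have decseq: "decseq G"
    by (rule decseq_SucI)
  have G_lim: "(\<lambda>k. G (s k)) \<longlonglongrightarrow> weiszfeld_objective A B b' V' L"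
    unfolding G_def by (rule tendsto_weiszfeld_objective[OF lim])
  \<comment> \<open>By monotonicity one step of the algorithm decreases \<open>G\<close> no more than one step of the
    subsequence.\<close>
  have upper: "v (s k) $ i / 2 * (norm (d (s k) $ i))\<^sup>2 \<le> G (s k) - G (s (Suc k))" for k i
  proof -
    have "Suc (s k) \<le> s (Suc k)"
      using s by (simp add: strict_monoD Suc_leI)
    then show ?thesis
      using row_le[of "s k" i] decseqD[OF decseq, of "Suc (s k)" "s (Suc k)"] by linarith
  qed
  have gap: "(\<lambda>k. G (s k) - G (s (Suc k))) \<longlonglongrightarrow> 0"
    using tendsto_diff[OF G_lim LIMSEQ_Suc[OF G_lim]] by simp
  have row_lim: "(\<lambda>k. d (s k) $ i) \<longlonglongrightarrow> 0" for i
  proof -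
    have "(\<lambda>k. v (s k) $ i / 2 * (norm (d (s k) $ i))\<^sup>2) \<longlonglongrightarrow> 0"
      using upper v_pos
      by (intro tendsto_sandwich[OF _ _ tendsto_const gap] always_eventually)
        (auto simp: less_imp_le)
    then have "(\<lambda>k. v (s k) $ i / 2 * (norm (d (s k) $ i))\<^sup>2 / (v (s k) $ i / 2)) \<longlonglongrightarrow> 0 / (vL $ i / 2)"
      using vL_pos[of i] by (intro tendsto_intros v_lim) auto
    moreover have "v (s k) $ i / 2 * (norm (d (s k) $ i))\<^sup>2 / (v (s k) $ i / 2)
        = (norm (d (s k) $ i))\<^sup>2" for k
      using v_pos[of "s k" i] by simp
    ultimately have "(\<lambda>k. (norm (d (s k) $ i))\<^sup>2) \<longlonglongrightarrow> 0"
      by simp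
    then have "(\<lambda>k. sqrt ((norm (d (s k) $ i))\<^sup>2)) \<longlonglongrightarrow> sqrt 0"
      by (rule tendsto_real_sqrt)
    then show ?thesis
      by (simp add: tendsto_norm_zero_iff)
  qed
  have stat: "A ** (b' + Diag (v k) ** (V' + transpose A ** \<Theta> k + d k)) = 0" for k
    using weiszfeld_step_stationary[OF rank nz[of k], of b']
    by (simp add: v_def d_def step linear_diff[OF linear_matrix_mult_left])
  have "(\<lambda>k. b' + Diag (v (s k)) ** (V' + transpose A ** \<Theta> (s k) + d (s k)))
      \<longlonglongrightarrow> b' + Diag vL ** (V' + transpose A ** L)"
  proof (rule vec_tendstoI)
    fix i
    have "(\<lambda>k. b' $ i + v (s k) $ i *\<^sub>R ((V' + transpose A ** \<Theta> (s k)) $ i + d (s k) $ i))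
        \<longlonglongrightarrow> b' $ i + vL $ i *\<^sub>R ((V' + transpose A ** L) $ i + 0)"
      by (intro tendsto_intros tendsto_matrix_mult_left v_lim lim row_lim)
    then show "(\<lambda>k. (b' + Diag (v (s k)) ** (V' + transpose A ** \<Theta> (s k) + d (s k))) $ i)
        \<longlonglongrightarrow> (b' + Diag vL ** (V' + transpose A ** L)) $ i"
      by (simp add: row_Diag_mult)
  qed
  then have "(\<lambda>k. A ** (b' + Diag (v (s k)) ** (V' + transpose A ** \<Theta> (s k) + d (s k))))
      \<longlonglongrightarrow> A ** (b' + Diag vL ** (V' + transpose A ** L))"
    by (rule tendsto_matrix_mult_left)
  then have "(\<lambda>k. 0) \<longlonglongrightarrow> A ** (b' + Diag vL ** (V' + transpose A ** L))"
    by (simp only: stat)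
  then show ?thesis
    unfolding vL_def by (metis LIMSEQ_unique tendsto_const)
qed

theorem theorem6:
  fixes A :: "real^'n^'m" and b :: "real^'m" and B :: "'n set"
    and b' R :: "real^'r::{finite,linorder}^'n"
  assumes "rank A = CARD('m)"
    and "\<forall>i. 0 \<le> b $ i"
    and "A ** b' = outer (A *v 1 - 2 *\<^sub>R b) e1"
    and "regular_point A b B R"
  shows "\<exists>\<epsilon>>0. \<forall>V\<in>ball R \<epsilon>.
    let V' = V - (1/2) *\<^sub>R outer 1 e1 in
    \<forall>(\<Theta> :: nat \<Rightarrow> real^'r::{finite,linorder}^'m) \<Theta>bar.
      (\<forall>k. \<Theta> (Suc k) = weiszfeld_step A B b' V' (\<Theta> k)) \<longrightarrow>
      accumulation_point \<Theta> \<Theta>bar \<longrightarrow>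
      (\<forall>i\<in>B. (V' + transpose A ** \<Theta>bar) $ i \<noteq> 0) \<longrightarrow>
      (\<forall>k. \<forall>i\<in>B. (V' + transpose A ** \<Theta> k) $ i \<noteq> 0) \<longrightarrow>
      (\<forall>\<Phi>. weiszfeld_objective A B b' V' \<Theta>bar \<le> weiszfeld_objective A B b' V' \<Phi>)"
  \<comment> \<open>The convergence argument is uniform in \<open>V'\<close>, so the value \<open>1\<close> is arbitrary.\<close>
proof (intro exI[of _ 1] conjI ballI)
  fix V :: "real^'r::{finite,linorder}^'n"
  define V' where "V' = V - (1/2) *\<^sub>R outer 1 (e1 :: real^'r::{finite,linorder})"
  have "weiszfeld_objective A B b' V' \<Theta>bar \<le> weiszfeld_objective A B b' V' \<Phi>"
    if "\<forall>k. \<Theta> (Suc k) = weiszfeld_step A B b' V' (\<Theta> k)"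
      and "accumulation_point \<Theta> \<Theta>bar"
      and "\<forall>i\<in>B. (V' + transpose A ** \<Theta>bar) $ i \<noteq> 0"
      and "\<forall>k. \<forall>i\<in>B. (V' + transpose A ** \<Theta> k) $ i \<noteq> 0"
    for \<Theta> :: "nat \<Rightarrow> real^'r::{finite,linorder}^'m" and \<Theta>bar \<Phi>
    using that assms(1)
    by (intro weiszfeld_stationary_imp_global_min
        weiszfeld_accumulation_point_stationary[where \<Theta> = \<Theta>]) auto
  then show "let V' = V - (1/2) *\<^sub>R outer 1 e1 in
    \<forall>(\<Theta> :: nat \<Rightarrow> real^'r::{finite,linorder}^'m) \<Theta>bar.
      (\<forall>k. \<Theta> (Suc k) = weiszfeld_step A B b' V' (\<Theta> k)) \<longrightarrow>
      accumulation_point \<Theta> \<Theta>bar \<longrightarrow>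
      (\<forall>i\<in>B. (V' + transpose A ** \<Theta>bar) $ i \<noteq> 0) \<longrightarrow>
      (\<forall>k. \<forall>i\<in>B. (V' + transpose A ** \<Theta> k) $ i \<noteq> 0) \<longrightarrow>
      (\<forall>\<Phi>. weiszfeld_objective A B b' V' \<Theta>bar \<le> weiszfeld_objective A B b' V' \<Phi>)"
    unfolding Let_def V'_def[symmetric] by blast
qed simp

end
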